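(* Assume $K(x,y)>0$, $\mu(x)>0$, $\nu(y)>0$ for all $x,y\in S$. Let $g_t$, $t\ge0$, be the solution of $$\dot g_t=-\log\frac{m_{g_t}}{\nu}+\mathbb E_\nu\!\left[\log\frac{m_{g_t}}{\nu}\right]\mathbf 1$$ with initial condition $g_0\in\mathcal H$, and let $g^\star$ be the unique element of $\mathcal H$ with $m_{g^\star}=\nu$. Then $$\|\pi_{g_t}-\pi_{g^\star}\|_{\mathrm{TV}}\to0,\qquad\|\mathbf P^{g_t}-\mathbf P^{g^\star}\|_{\mathrm{TV}}\to0,\qquad t\to\infty.$$
   Context: Let $N\ge1$ be an integer and $S=\{1,\dots,N\}$. Let $Q\in\mathbb R^{N\times N}$ be the generator of a continuous-time Markov chain on $S$ (nonnegative off-diagonal entries, rows summing to zero) and $K=e^{Q}$. Let $\mu,\nu$ be probability distributions on $S$. $\mathbf 1$ is the constant function $1$ on $S$; $\mathbb E_\nu[f]=\sum_{y\in S}\nu(y)f(y)$; $\log\frac{m}{\nu}$ is the function $y\mapsto\log(m(y)/\nu(y))$; $\|\cdot\|_{\mathrm{TV}}$ is the total variation norm. For $g\in\mathbb R^S$ set $Z_g(x)=\sum_{z\in S}K(x,z)e^{g(z)}$, $p_g(y|x)=\frac{K(x,y)e^{g(y)}}{Z_g(x)}$, $\pi_g(x,y)=\mu(x)p_g(y|x)$ (a probability distribution on $S\times S$), and $m_g(y)=\sum_{x\in S}\pi_g(x,y)$ (strictly positive). The gauge-fixed space is $\mathcal H=\{g\in\mathbb R^S:\mathbb E_\nu[g]=0\}$.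 For every $g_0\in\mathcal H$ the ODE $\dot g_t=-\log\frac{m_{g_t}}{\nu}+\mathbb E_\nu\!\left[\log\frac{m_{g_t}}{\nu}\right]\mathbf 1$ with initial condition $g_{t=0}=g_0$ has a unique global solution, which stays in $\mathcal H$; there is a unique $g^\star\in\mathcal H$ with $m_{g^\star}=\nu$. Let $\Omega=D([0,1],S)$ be the Skorokhod space of càdlàg paths with values in $S$, with coordinate process $(X_t)_{t\in[0,1]}$, and let $\mathbf R_\mu$ be the law on $\Omega$ of the continuous-time Markov chain with generator $Q$ and $X_0\sim\mu$, so that $\mathbf R_\mu(X_0=x,X_1=y)=\mu(x)K(x,y)$. For $g\in\mathbb R^S$ define the path measure $$\mathbf P^g(d\omega)=\sum_{x,y\in S}\pi_g(x,y)\,\mathbf R_\mu(d\omega\mid X_0=x,X_1=y).$$ *)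

theory Defs
  imports "HOL-Probability.Probability"
begin

text \<open>
  The state space is a finite type \<open>'n\<close>. Functions and distributions on it are
  vectors in \<open>real ^ 'n\<close>; matrices have rows \<open>A $ x\<close>, so that \<open>A $ x $ y\<close> is the
  entry \<open>A(x, y)\<close>.
\<close>

text \<open>The power \<open>^\<close> on \<open>real ^ 'n ^ 'n\<close> is not the matrix power.\<close>

definition mat_pow :: "real ^ 'n ^ 'n \<Rightarrow> nat \<Rightarrow> real ^ 'n ^ 'n" where
  "mat_pow A k = ((\<lambda>B. A ** B) ^^ k) (mat 1)"

definition mat_exp :: "real ^ 'n ^ 'n \<Rightarrow> real ^ 'n ^ 'n" where
  "mat_exp A = (\<Sum>k. mat_pow A k /\<^sub>R fact k)"

definition is_generator :: "real ^ 'n ^ 'n \<Rightarrow> bool" where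
  "is_generator Q \<longleftrightarrow>
     (\<forall>x y. x \<noteq> y \<longrightarrow> 0 \<le> Q $ x $ y) \<and> (\<forall>x. (\<Sum>y\<in>UNIV. Q $ x $ y) = 0)"

definition is_distribution :: "real ^ 'n \<Rightarrow> bool" where
  "is_distribution p \<longleftrightarrow> (\<forall>x. 0 \<le> p $ x) \<and> (\<Sum>x\<in>UNIV. p $ x) = 1"

definition expect :: "real ^ 'n \<Rightarrow> real ^ 'n \<Rightarrow> real" where
  "expect p f = (\<Sum>y\<in>UNIV. p $ y * f $ y)"

definition norm_const :: "real ^ 'n ^ 'n \<Rightarrow> real ^ 'n \<Rightarrow> 'n \<Rightarrow> real" where
  "norm_const K g x = (\<Sum>z\<in>UNIV. K $ x $ z * exp (g $ z))"

text \<open>\<open>p_cond K g x y\<close> is \<open>p_g(y | x)\<close>.\<close>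

definition p_cond :: "real ^ 'n ^ 'n \<Rightarrow> real ^ 'n \<Rightarrow> 'n \<Rightarrow> 'n \<Rightarrow> real" where
  "p_cond K g x y = K $ x $ y * exp (g $ y) / norm_const K g x"

definition coupling :: "real ^ 'n ^ 'n \<Rightarrow> real ^ 'n \<Rightarrow> real ^ 'n \<Rightarrow> 'n \<Rightarrow> 'n \<Rightarrow> real" where
  "coupling K \<mu> g x y = \<mu> $ x * p_cond K g x y"

definition coupling_measure ::
    "real ^ 'n ^ 'n \<Rightarrow> real ^ 'n \<Rightarrow> real ^ 'n \<Rightarrow> ('n \<times> 'n) measure" where
  "coupling_measure K \<mu> g = point_measure UNIV (\<lambda>(x, y). ennreal (coupling K \<mu> g x y))"

definition marginal :: "real ^ 'n ^ 'n \<Rightarrow> real ^ 'n \<Rightarrow> real ^ 'n \<Rightarrow> real ^ 'n" where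
  "marginal K \<mu> g = (\<chi> y. \<Sum>x\<in>UNIV. coupling K \<mu> g x y)"

definition log_ratio :: "real ^ 'n \<Rightarrow> real ^ 'n \<Rightarrow> real ^ 'n" where
  "log_ratio m \<nu> = (\<chi> y. ln (m $ y / \<nu> $ y))"

definition gauge_space :: "real ^ 'n \<Rightarrow> (real ^ 'n) set" where
  "gauge_space \<nu> = {g. expect \<nu> g = 0}"

definition flow_field ::
    "real ^ 'n ^ 'n \<Rightarrow> real ^ 'n \<Rightarrow> real ^ 'n \<Rightarrow> real ^ 'n \<Rightarrow> real ^ 'n" where
  "flow_field K \<mu> \<nu> g =
     - log_ratio (marginal K \<mu> g) \<nu>
     + expect \<nu> (log_ratio (marginal K \<mu> g) \<nu>) *\<^sub>R (\<chi> y. 1)"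

text \<open>
  A path is represented by a function on the reals that is \<open>undefined\<close> outside
  \<open>[0, 1]\<close>; the state space carries the discrete topology.
\<close>

definition cadlag_paths :: "(real \<Rightarrow> 's) set" where
  "cadlag_paths = {\<omega> \<in> extensional {0..1}.
     (\<forall>t\<in>{0..<1}. limitin (discrete_topology UNIV) \<omega> (\<omega> t) (at_right t)) \<and>
     (\<forall>t\<in>{0<..1}. \<exists>l. limitin (discrete_topology UNIV) \<omega> l (at_left t))}"

text \<open>
  The \<open>\<sigma>\<close>-algebra is the one generated by the coordinate maps, i.e. the trace of
  the product \<open>\<sigma>\<close>-algebra; it coincides with the Borel \<open>\<sigma>\<close>-algebra of the
  Skorokhod topology. Only the space and the \<open>\<sigma>\<close>-algebra of this measure matter.
\<close>

definition path_space :: "(real \<Rightarrow> 's) measure" where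
  "path_space = restrict_space (Pi\<^sub>M {0..1} (\<lambda>_. count_space UNIV)) cadlag_paths"

text \<open>
  A law on path space is the law of the Markov chain with generator \<open>Q\<close> and initial
  distribution \<open>\<mu>\<close> if its finite-dimensional distributions are the ones given by
  the transition semigroup \<open>exp (t Q)\<close>. This determines the law uniquely.
\<close>

definition is_markov_law ::
    "real ^ 'n ^ 'n \<Rightarrow> real ^ 'n \<Rightarrow> (real \<Rightarrow> 'n) measure \<Rightarrow> bool" where
  "is_markov_law Q \<mu> R \<longleftrightarrow>
     prob_space R \<and> space R = space path_space \<and> sets R = sets path_space \<and>
     (\<forall>(n :: nat) (t :: nat \<Rightarrow> real) (x :: nat \<Rightarrow> 'n).
        t 0 = 0 \<and> (\<forall>i<n. t i < t (Suc i)) \<and> t n \<le> 1 \<longrightarrow>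
        measure R {\<omega> \<in> space R. \<forall>i\<le>n. \<omega> (t i) = x i} =
          \<mu> $ x 0 * (\<Prod>i<n. mat_exp ((t (Suc i) - t i) *\<^sub>R Q) $ x i $ x (Suc i)))"

definition bridge :: "(real \<Rightarrow> 'n) measure \<Rightarrow> 'n \<Rightarrow> 'n \<Rightarrow> (real \<Rightarrow> 'n) measure" where
  "bridge R x y = uniform_measure R {\<omega> \<in> space R. \<omega> 0 = x \<and> \<omega> 1 = y}"

definition path_measure ::
    "(real \<Rightarrow> 'n) measure \<Rightarrow> real ^ 'n ^ 'n \<Rightarrow> real ^ 'n \<Rightarrow> real ^ 'n \<Rightarrow> (real \<Rightarrow> 'n) measure"
  where
  "path_measure R K \<mu> g = measure_of (space path_space) (sets path_space)
     (\<lambda>A. \<Sum>x\<in>UNIV. \<Sum>y\<in>UNIV. ennreal (coupling K \<mu> g x y) * emeasure (bridge R x y) A)"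

text \<open>
  Total variation norm of the signed measure \<open>M - N\<close>, for finite measures \<open>M\<close> and \<open>N\<close>
  on the same \<open>\<sigma>\<close>-algebra. No factor \<open>1/2\<close> is included.
\<close>

definition tv_dist :: "'a measure \<Rightarrow> 'a measure \<Rightarrow> ennreal" where
  "tv_dist M N =
     (SUP P \<in> {P. finite P \<and> partition_on (space M) P \<and> P \<subseteq> sets M}.
        \<Sum>A\<in>P. ennreal \<bar>measure M A - measure N A\<bar>)"

end

theory Submission
  imports Defs
begin

text \<open>
  Write \<open>h\<close> for the limit potential, so that \<open>m\<^sub>h = \<nu>\<close>, and \<open>u = g\<^sub>t - h\<close>. The two normalisations in
  \<open>m\<^sub>g(y) / m\<^sub>h(y)\<close> combine to
  \<open>exp (u(y)) * (\<Sum>x. q(x | y) * (Z\<^sub>h(x) / Z\<^sub>g(x)))\<close>, where \<open>q(\<cdot> | y)\<close> is the conditional law of \<open>x\<close>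
  under \<open>\<pi>\<^sub>h\<close>, and \<open>Z\<^sub>g(x) / Z\<^sub>h(x)\<close> is itself the average of \<open>exp \<circ> u\<close> under \<open>p\<^sub>h(\<cdot> | x)\<close>.
  So the flow reads \<open>u' = v - u + const\<close>, where \<open>v = u - log (m\<^sub>g / \<nu>)\<close> arises from \<open>u\<close> by two
  averagings, as in one step of Sinkhorn's algorithm. The weights \<open>p\<^sub>h\<close> are bounded
  below by some \<open>\<epsilon> > 0\<close>, so the averaging shrinks the oscillation \<open>max - min\<close> by the factor
  \<open>1 - \<epsilon>\<close> (\<open>log_marginal_ratio_contraction\<close>). A maximum principle turns this into exponential
  decay, \<open>osc u\<^sub>t \<le> exp (- \<epsilon> t) osc u\<^sub>0\<close> (\<open>flow_differences_decay\<close>).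
  
  The coupling \<open>\<pi>\<^sub>g\<close> sees only the differences \<open>g(y) - g(z)\<close> and is continuous in them, so
  \<open>\<pi>\<close> converges entrywise along the flow. Both the coupling, as a measure, and the path measure
  are mixtures with weights \<open>\<pi>\<^sub>g(x, y)\<close>, of point masses and of bridges respectively, and the
  total variation between two mixtures of the same components is at most the \<open>\<ell>\<^sup>1\<close>
  distance of the weights (\<open>tv_dist_mixture_le\<close>).
\<close>

section \<open>A maximum principle for finite families of functions\<close>

text \<open>
  With \<open>S\<close> the largest value of the family on \<open>[0, T]\<close>, attained by \<open>f k\<close> at the time \<open>\<tau>\<close>, the bound
  \<open>f k' \<le> c (S - f k)\<close> makes \<open>exp (c s) (f k s - S)\<close> nonincreasing. It vanishes at
  \<open>\<tau>\<close>, so it is nonnegative at \<open>0\<close>, i.e. \<open>S\<close> was already reached at time \<open>0\<close>. The family is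
  indexed because the function realising the maximum may change with time, which keeps the maximum
  itself from being differentiable.
\<close>

lemma finite_family_max_principle:
  fixes f f' :: "'i::finite \<Rightarrow> real \<Rightarrow> real" and c M\<^sub>0 T :: real
  assumes deriv: "\<And>i t. t \<ge> 0 \<Longrightarrow> (f i has_real_derivative f' i t) (at t within {0..})"
    and bound: "\<And>i t M. t \<ge> 0 \<Longrightarrow> (\<And>j. f j t \<le> M) \<Longrightarrow> f' i t \<le> c * (M - f i t)"
    and init: "\<And>i. f i 0 \<le> M\<^sub>0"
    and "T \<ge> 0"
  shows "f i T \<le> M\<^sub>0"
proof -
  have cont: "continuous_on {0..} (f j)" for j
    using deriv by (intro DERIV_continuous_on[where D = "f' j"]) auto
  have "\<exists>t\<in>{0..T}. \<forall>s\<in>{0..T}. f j s \<le> f j t" for j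
    using \<open>T \<ge> 0\<close> by (intro continuous_attains_sup continuous_on_subset[OF cont]) auto
  then obtain \<tau> where \<tau>: "\<And>j. \<tau> j \<in> {0..T}" "\<And>j s. s \<in> {0..T} \<Longrightarrow> f j s \<le> f j (\<tau> j)"
    by metis
  obtain k where k: "\<And>j. f j (\<tau> j) \<le> f k (\<tau> k)"
  proof -
    have "Max (range (\<lambda>j. f j (\<tau> j))) \<in> range (\<lambda>j. f j (\<tau> j))"
      by (intro Max_in) auto
    then obtain k where "Max (range (\<lambda>j. f j (\<tau> j))) = f k (\<tau> k)"
      unfolding image_iff by blast
    then show thesis
      by (intro that[of k]) (metis Max_ge finite finite_imageI rangeI)
  qed
  define S where "S = f k (\<tau> k)"
  have S: "f j s \<le> S" if "s \<in> {0..T}" for j s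
    using \<tau>(2)[OF that, of j] k[of j] unfolding S_def by linarith
  define w where "w s = exp (c * s) * (f k s - S)" for s
  have "w (\<tau> k) \<le> w 0"
  proof (cases "\<tau> k = 0")
    case False
    with \<tau>(1)[of k] have pos: "0 < \<tau> k" by auto
    show ?thesis
    proof (rule DERIV_nonpos_imp_decreasing_open[OF less_imp_le[OF pos]])
      fix s assume s: "0 < s" "s < \<tau> k"
      have "(f k has_real_derivative f' k s) (at s)"
        using DERIV_subset[OF deriv[of s k], of "{0<..}"] s
        by (auto simp: at_within_open[of s "{0<..}"] subset_eq)
      then have "(w has_real_derivative
          exp (c * s) * (f' k s - 0) + c * 1 * exp (c * s) * (f k s - S)) (at s)"
        unfolding w_def by (auto intro!: derivative_eq_intros)
      then have "(w has_real_derivative exp (c * s) * (f' k s - c * (S - f k s))) (at s)"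
        by (rule DERIV_cong) (simp add: algebra_simps)
      moreover have "f' k s \<le> c * (S - f k s)"
        using s \<tau>(1)[of k] by (intro bound S) auto
      ultimately show "\<exists>y. (w has_real_derivative y) (at s) \<and> y \<le> 0"
        by (metis diff_le_0_iff_le exp_ge_zero mult_nonneg_nonpos)
    next
      show "continuous_on {0..\<tau> k} w"
        unfolding w_def by (intro continuous_intros continuous_on_subset[OF cont]) auto
    qed
  qed simp
  then have "S \<le> f k 0" by (simp add: w_def S_def)
  then show ?thesis using S[of T i] init[of k] \<open>T \<ge> 0\<close> by auto
qed

section \<open>Finite averages\<close>

text \<open>
  Jensen's inequality for the exponential, from its tangent line at the mean.
\<close>

lemma sum_exp_ge_exp_mean:
  fixes p u :: "'i::finite \<Rightarrow> real"
  assumes "\<And>i. 0 \<le> p i" and "(\<Sum>i\<in>UNIV. p i) = 1"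
  shows "exp (\<Sum>i\<in>UNIV. p i * u i) \<le> (\<Sum>i\<in>UNIV. p i * exp (u i))"
proof -
  define a where "a = (\<Sum>i\<in>UNIV. p i * u i)"
  have tangent: "exp a * (1 + (s - a)) \<le> exp s" for s
  proof -
    have "exp a * (1 + (s - a)) \<le> exp a * exp (s - a)"
      using exp_ge_add_one_self[of "s - a"] by (intro mult_left_mono) auto
    then show ?thesis by (simp flip: exp_add)
  qed
  have "exp a = exp a * ((1 - a) * (\<Sum>i\<in>UNIV. p i) + (\<Sum>i\<in>UNIV. p i * u i))"
    by (simp add: assms(2) a_def)
  also have "\<dots> = (\<Sum>i\<in>UNIV. p i * (exp a * (1 + (u i - a))))"
    by (simp add: sum_distrib_left sum_distrib_right sum.distrib[symmetric] algebra_simps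
        del: assms(2))
  also have "\<dots> \<le> (\<Sum>i\<in>UNIV. p i * exp (u i))"
    by (intro sum_mono mult_left_mono tangent assms(1))
  finally show ?thesis by (simp add: a_def)
qed

lemma average_between:
  fixes p f :: "'i::finite \<Rightarrow> real"
  assumes "\<And>i. 0 \<le> p i" and "(\<Sum>i\<in>UNIV. p i) = 1" and "\<And>i. a \<le> f i" and "\<And>i. f i \<le> b"
  shows "a \<le> (\<Sum>i\<in>UNIV. p i * f i)" and "(\<Sum>i\<in>UNIV. p i * f i) \<le> b"
proof -
  have "(\<Sum>i\<in>UNIV. p i * a) \<le> (\<Sum>i\<in>UNIV. p i * f i)"
    "(\<Sum>i\<in>UNIV. p i * f i) \<le> (\<Sum>i\<in>UNIV. p i * b)"
    by (intro sum_mono mult_left_mono assms)+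
  then show "a \<le> (\<Sum>i\<in>UNIV. p i * f i)" "(\<Sum>i\<in>UNIV. p i * f i) \<le> b"
    by (simp_all add: assms(2) flip: sum_distrib_right)
qed

section \<open>Oscillation contraction of the Sinkhorn map\<close>

context
  fixes K :: "real ^ 'n ^ 'n"
  assumes K_pos: "\<And>x y. K $ x $ y > 0"
begin

lemma norm_const_pos: "norm_const K g x > 0"
  unfolding norm_const_def by (intro sum_pos) (auto simp: K_pos)

lemma p_cond_pos: "p_cond K g x y > 0"
  unfolding p_cond_def by (simp add: K_pos norm_const_pos)

lemma sum_p_cond: "(\<Sum>y\<in>UNIV. p_cond K g x y) = 1"
  using norm_const_pos[of g x]
  by (simp add: p_cond_def flip: sum_divide_distrib norm_const_def)

text \<open>
  Adding a constant to the potential cancels against the normalisation. This form makes the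
  invariance visible, and with it continuity in the differences.
\<close>

lemma p_cond_eq_differences:
  "p_cond K g x y = K $ x $ y / (\<Sum>z\<in>UNIV. K $ x $ z * exp (g $ z - g $ y))"
proof -
  have "norm_const K g x = exp (g $ y) * (\<Sum>z\<in>UNIV. K $ x $ z * exp (g $ z - g $ y))"
    by (simp add: norm_const_def sum_distrib_left exp_diff)
  then show ?thesis by (simp add: p_cond_def)
qed

lemma tendsto_coupling_of_differences:
  assumes "\<And>y z. ((\<lambda>t. g t $ z - g t $ y) \<longlongrightarrow> h $ z - h $ y) F"
  shows "((\<lambda>t. coupling K \<mu> (g t) x y) \<longlongrightarrow> coupling K \<mu> h x y) F"
proof -
  have "(\<Sum>z\<in>UNIV. K $ x $ z * exp (h $ z - h $ y)) > 0"
    by (intro sum_pos) (auto simp: K_pos)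
  then show ?thesis
    unfolding coupling_def p_cond_eq_differences
    by (intro tendsto_intros assms) auto
qed

lemma norm_const_ratio:
  "norm_const K g x / norm_const K h x = (\<Sum>z\<in>UNIV. p_cond K h x z * exp (g $ z - h $ z))"
  by (simp add: p_cond_def norm_const_def[of K g] sum_divide_distrib exp_diff)

text \<open>
  The strict gain: by Jensen, the average of \<open>exp \<circ> u\<close> is at least \<open>exp\<close> of the average of \<open>u\<close>,
  and the latter exceeds the minimum of \<open>u\<close> by \<open>\<epsilon>\<close> times the oscillation because the point \<open>y\<^sub>1\<close> where
  \<open>u\<close> is maximal has weight at least \<open>\<epsilon>\<close>. Through Jensen both bounds become
  exponentials of expressions linear in \<open>u\<close>, so that logarithms give a linear contraction. The gain sits
  in the lower bound alone; that already shortens the interval by \<open>\<epsilon>\<close> times its length.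
\<close>

lemma norm_const_ratio_bounds:
  assumes lo: "\<And>z. g $ y\<^sub>0 - h $ y\<^sub>0 \<le> g $ z - h $ z"
    and hi: "\<And>z. g $ z - h $ z \<le> g $ y\<^sub>1 - h $ y\<^sub>1"
    and \<epsilon>: "\<And>z. \<epsilon> \<le> p_cond K h x z"
  defines "u \<equiv> \<lambda>z. g $ z - h $ z"
  shows "exp (u y\<^sub>0 + \<epsilon> * (u y\<^sub>1 - u y\<^sub>0)) \<le> norm_const K g x / norm_const K h x"
    and "norm_const K g x / norm_const K h x \<le> exp (u y\<^sub>1)"
proof -
  let ?p = "p_cond K h x"
  have p: "0 \<le> ?p z" for z using p_cond_pos[of h x z] by simp
  have "\<epsilon> * (u y\<^sub>1 - u y\<^sub>0) \<le> ?p y\<^sub>1 * (u y\<^sub>1 - u y\<^sub>0)"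
    using lo[of y\<^sub>1] by (intro mult_right_mono \<epsilon>) (simp add: u_def)
  also have "\<dots> \<le> (\<Sum>z\<in>UNIV. ?p z * (u z - u y\<^sub>0))"
    by (intro member_le_sum) (use lo p in \<open>auto simp: u_def\<close>)
  also have "\<dots> = (\<Sum>z\<in>UNIV. ?p z * u z) - u y\<^sub>0"
    by (simp add: right_diff_distrib sum_subtractf sum_p_cond flip: sum_distrib_right)
  finally have "exp (u y\<^sub>0 + \<epsilon> * (u y\<^sub>1 - u y\<^sub>0)) \<le> exp (\<Sum>z\<in>UNIV. ?p z * u z)" by simp
  also have "\<dots> \<le> (\<Sum>z\<in>UNIV. ?p z * exp (u z))"
    by (rule sum_exp_ge_exp_mean[OF p sum_p_cond])
  finally show "exp (u y\<^sub>0 + \<epsilon> * (u y\<^sub>1 - u y\<^sub>0)) \<le> norm_const K g x / norm_const K h x"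
    by (simp add: norm_const_ratio u_def)
  show "norm_const K g x / norm_const K h x \<le> exp (u y\<^sub>1)"
    unfolding norm_const_ratio u_def
    by (rule average_between(2)[OF p sum_p_cond, of "0"]) (use hi in auto)
qed

context
  fixes \<mu> :: "real ^ 'n"
  assumes \<mu>_pos: "\<And>x. \<mu> $ x > 0"
begin

lemma coupling_pos: "coupling K \<mu> g x y > 0"
  by (simp add: coupling_def \<mu>_pos p_cond_pos)

lemma marginal_pos: "marginal K \<mu> g $ y > 0"
  unfolding marginal_def by (simp, intro sum_pos) (auto simp: coupling_pos)

lemma marginal_ratio:
  "marginal K \<mu> g $ y / marginal K \<mu> h $ y = exp (g $ y - h $ y) *
     (\<Sum>x\<in>UNIV. coupling K \<mu> h x y / marginal K \<mu> h $ y * (norm_const K h x / norm_const K g x))"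
proof -
  have "coupling K \<mu> g x y
      = exp (g $ y - h $ y) * (coupling K \<mu> h x y * (norm_const K h x / norm_const K g x))" for x
    using norm_const_pos[of h x] by (simp add: coupling_def p_cond_def exp_diff)
  then have "marginal K \<mu> g $ y = exp (g $ y - h $ y) *
      (\<Sum>x\<in>UNIV. coupling K \<mu> h x y * (norm_const K h x / norm_const K g x))"
    (is "_ = ?e * (\<Sum>x\<in>_. ?c x * ?r x)")
    unfolding marginal_def[of K \<mu> g] by (simp add: sum_distrib_left)
  moreover have "?e * s / c = ?e * (s / c)" for s c :: real by simp
  moreover have "(\<Sum>x\<in>UNIV. ?c x * ?r x) / c = (\<Sum>x\<in>UNIV. ?c x / c * ?r x)" for c :: real
    unfolding sum_divide_distrib by (intro sum.cong) simp_all
  ultimately show ?thesis by (simp only:)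
qed

text \<open>
  Since \<open>v\<close> is minus the logarithm of an average over \<open>x\<close> of \<open>Z\<^sub>h(x) / Z\<^sub>g(x)\<close>, the bounds on these
  ratios pass to \<open>v\<close>: an average stays in any interval that contains the averaged values.
\<close>

lemma log_marginal_ratio_contraction:
  assumes \<epsilon>: "\<And>x z. \<epsilon> \<le> p_cond K h x z"
    and D: "\<And>y z. (g $ y - h $ y) - (g $ z - h $ z) \<le> D"
  defines "v \<equiv> \<lambda>y. (g $ y - h $ y) - ln (marginal K \<mu> g $ y / marginal K \<mu> h $ y)"
  shows "v y - v z \<le> (1 - \<epsilon>) * D"
proof -
  define u where "u z = g $ z - h $ z" for z
  have fin: "finite (range u)" "range u \<noteq> {}" by auto
  obtain y\<^sub>0 y\<^sub>1 where "Min (range u) = u y\<^sub>0" "Max (range u) = u y\<^sub>1"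
    using Min_in[OF fin] Max_in[OF fin] unfolding image_iff by blast
  then have lo: "u y\<^sub>0 \<le> u z" and hi: "u z \<le> u y\<^sub>1" for z
    using Min_le[OF fin(1), of "u z"] Max_ge[OF fin(1), of "u z"] by auto
  \<comment> \<open>Lower bound for \<open>v\<close>; the matching upper bound is the maximum \<open>u y\<^sub>1\<close> of \<open>u\<close>.\<close>
  define A where "A = u y\<^sub>0 + \<epsilon> * (u y\<^sub>1 - u y\<^sub>0)"
  have v_bounds: "A \<le> v y \<and> v y \<le> u y\<^sub>1" for y
  proof -
    define q where "q x = coupling K \<mu> h x y / marginal K \<mu> h $ y" for x
    have q: "0 \<le> q x" for x
      using coupling_pos[of h x y] marginal_pos[of h y] by (simp add: q_def)
    have q1: "(\<Sum>x\<in>UNIV. q x) = 1"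
      using marginal_pos[of h y] by (simp add: q_def marginal_def flip: sum_divide_distrib)
    define r where "r x = norm_const K h x / norm_const K g x" for x
    have r: "exp (- u y\<^sub>1) \<le> r x" "r x \<le> exp (- A)" for x
    proof -
      have "exp A \<le> norm_const K g x / norm_const K h x"
        "norm_const K g x / norm_const K h x \<le> exp (u y\<^sub>1)"
        using norm_const_ratio_bounds[of g y\<^sub>0 h y\<^sub>1 \<epsilon> x] lo hi \<epsilon>
        by (simp_all add: A_def u_def)
      then show "exp (- u y\<^sub>1) \<le> r x" "r x \<le> exp (- A)"
        using norm_const_pos[of g x] norm_const_pos[of h x]
        by (simp_all add: r_def exp_minus field_simps)
    qed
    define a where "a = (\<Sum>x\<in>UNIV. q x * r x)"
    have a: "exp (- u y\<^sub>1) \<le> a" "a \<le> exp (- A)"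
      unfolding a_def using average_between[OF q q1 r] by auto
    then have a_pos: "a > 0" using exp_gt_zero[of "- u y\<^sub>1"] by linarith
    have "v y = - ln a"
      using a_pos unfolding v_def marginal_ratio
      by (simp add: ln_mult flip: q_def r_def a_def)
    moreover have "- u y\<^sub>1 \<le> ln a" "ln a \<le> - A"
      using a a_pos ln_le_cancel_iff[of a "exp (- A)"] by (simp_all add: ln_ge_iff)
    ultimately show ?thesis by auto
  qed
  have "\<epsilon> \<le> 1"
  proof -
    have "p_cond K h undefined undefined \<le> (\<Sum>y\<in>UNIV. p_cond K h undefined y)"
      by (intro member_le_sum) (auto intro: less_imp_le p_cond_pos)
    with \<epsilon>[of undefined undefined] show ?thesis by (simp add: sum_p_cond)
  qed
  have "v y - v z \<le> (1 - \<epsilon>) * (u y\<^sub>1 - u y\<^sub>0)"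
    using v_bounds[of y] v_bounds[of z] by (simp add: A_def algebra_simps)
  also have "\<dots> \<le> (1 - \<epsilon>) * D"
    using \<open>\<epsilon> \<le> 1\<close> D[of y\<^sub>1 y\<^sub>0] by (intro mult_left_mono) (auto simp: u_def)
  finally show ?thesis .
qed

section \<open>Decay of oscillations along the flow\<close>

text \<open>
  Taking differences of components removes the scalar multiple of \<open>\<one>\<close> from the flow. The maximum
  principle is applied to the family \<open>exp (\<epsilon> t) (u(y) - u(z))\<close>, indexed by pairs \<open>(y, z)\<close>, whose
  maximum is the rescaled oscillation: the derivative of \<open>u(y) - u(z)\<close> is
  \<open>(v(y) - v(z)) - (u(y) - u(z))\<close>, and the contraction bounds the first difference by
  \<open>(1 - \<epsilon>) osc u\<close>.
\<close>

lemma flow_differences_decay: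
  assumes flow: "\<And>t. t \<ge> 0 \<Longrightarrow>
      (g has_vector_derivative flow_field K \<mu> (marginal K \<mu> h) (g t)) (at t within {0..})"
    and \<epsilon>: "\<And>x z. \<epsilon> \<le> p_cond K h x z"
    and D: "\<And>y z. (g 0 $ y - h $ y) - (g 0 $ z - h $ z) \<le> D"
    and "t \<ge> 0"
  shows "(g t $ y - h $ y) - (g t $ z - h $ z) \<le> exp (- \<epsilon> * t) * D"
proof -
  define u where "u t y = g t $ y - h $ y" for t y
  define L where "L t y = ln (marginal K \<mu> (g t) $ y / marginal K \<mu> h $ y)" for t y
  define f where "f = (\<lambda>(y, z) t. exp (\<epsilon> * t) * (u t y - u t z))"
  define f' where
    "f' = (\<lambda>(y, z) t. exp (\<epsilon> * t) * (\<epsilon> * (u t y - u t z) - (L t y - L t z)))"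
  have "f (y, z) t \<le> D"
  proof (rule finite_family_max_principle[of f f' "1 - \<epsilon>"])
    fix i :: "'n \<times> 'n" and t :: real assume t: "t \<ge> 0"
    obtain y z where i: "i = (y, z)" by (cases i)
    have component: "((\<lambda>t. g t $ y) has_real_derivative
        flow_field K \<mu> (marginal K \<mu> h) (g t) $ y) (at t within {0..})" for y
      using bounded_linear.has_vector_derivative[OF bounded_linear_vec_nth flow[OF t]]
      by (simp add: has_real_derivative_iff_has_vector_derivative)
    show "(f i has_real_derivative f' i t) (at t within {0..})"
      unfolding i f_def f'_def u_def L_def
      by (auto intro!: derivative_eq_intros component
          simp: flow_field_def log_ratio_def algebra_simps)
    fix M assume M: "\<And>j. f j t \<le> M"
    have "u t a - u t b \<le> exp (- \<epsilon> * t) * M" for a b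
      using M[of "(a, b)"] by (simp add: f_def exp_minus field_simps)
    from log_marginal_ratio_contraction[OF \<epsilon> this[unfolded u_def], of y z]
    have "(u t y - L t y) - (u t z - L t z) \<le> (1 - \<epsilon>) * (exp (- \<epsilon> * t) * M)"
      by (simp add: u_def L_def)
    then have "exp (\<epsilon> * t) * ((u t y - L t y) - (u t z - L t z)) \<le> (1 - \<epsilon>) * M"
      by (simp add: exp_minus field_simps)
    then show "f' i t \<le> (1 - \<epsilon>) * (M - f i t)"
      by (simp add: i f_def f'_def algebra_simps)
  next
    show "f i 0 \<le> D" for i using D by (cases i) (simp add: f_def u_def)
  qed (rule \<open>t \<ge> 0\<close>)
  then show ?thesis by (simp add: f_def u_def exp_minus field_simps)
qed

lemma tendsto_flow_differences:
  assumes flow: "\<And>t. t \<ge> 0 \<Longrightarrow>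
      (g has_vector_derivative flow_field K \<mu> (marginal K \<mu> h) (g t)) (at t within {0..})"
  shows "((\<lambda>t. g t $ y - g t $ z) \<longlongrightarrow> h $ y - h $ z) at_top"
proof -
  define p where "p i = p_cond K h (fst i) (snd i)" for i
  define \<epsilon> where "\<epsilon> = Min (range p)"
  have "\<epsilon> \<in> range p" unfolding \<epsilon>_def by (intro Min_in) auto
  then have "\<epsilon> > 0" using p_cond_pos by (auto simp: p_def)
  have "\<epsilon> \<le> p i" for i unfolding \<epsilon>_def by (rule Min_le) auto
  from this[of "(_, _)"] have \<epsilon>: "\<epsilon> \<le> p_cond K h x z" for x z by (simp add: p_def)
  define d where "d i = (g 0 $ fst i - h $ fst i) - (g 0 $ snd i - h $ snd i)" for i
  define D where "D = Max (range d)"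
  have "d i \<le> D" for i unfolding D_def by (rule Max_ge) auto
  from this[of "(_, _)"] have D: "(g 0 $ y - h $ y) - (g 0 $ z - h $ z) \<le> D" for y z
    by (simp add: d_def)
  have decay: "(g t $ y - h $ y) - (g t $ z - h $ z) \<le> exp (- \<epsilon> * t) * D" if "t \<ge> 0" for t y z
    by (rule flow_differences_decay[OF flow \<epsilon> D that])
  have "filterlim (\<lambda>t. - \<epsilon> * t) at_bot at_top"
    using \<open>\<epsilon> > 0\<close> by (intro filterlim_tendsto_neg_mult_at_bot[OF tendsto_const _ filterlim_ident]) auto
  then have "((\<lambda>t. exp (- \<epsilon> * t)) \<longlongrightarrow> 0) at_top"
    by (rule filterlim_compose[OF exp_at_bot])
  then have "((\<lambda>t. exp (- \<epsilon> * t) * D) \<longlongrightarrow> 0) at_top"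
    by (rule tendsto_mult_left_zero)
  then have "((\<lambda>t. (g t $ y - h $ y) - (g t $ z - h $ z)) \<longlongrightarrow> 0) at_top"
  proof (rule Lim_null_comparison[rotated])
    show "\<forall>\<^sub>F t in at_top. norm ((g t $ y - h $ y) - (g t $ z - h $ z)) \<le> exp (- \<epsilon> * t) * D"
      using eventually_ge_at_top[of 0]
    proof eventually_elim
      case (elim t)
      show ?case using decay[OF elim, of y z] decay[OF elim, of z y] by (simp add: abs_le_iff)
    qed
  qed
  from tendsto_add[OF this tendsto_const[of "h $ y - h $ z"]] show ?thesis
    by (simp add: algebra_simps)
qed

end

end

section \<open>Total variation between mixtures\<close>

text \<open>
  Over the cells of a partition each component distributes at most its total mass \<open>1\<close>, so the
  difference \<open>w i - w' i\<close> contributes at most its absolute value.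
\<close>

lemma tv_dist_mixture_le:
  fixes w w' :: "'i::finite \<Rightarrow> real" and W :: "'i \<Rightarrow> 'a measure"
  assumes sets_W: "\<And>i. sets (W i) = sets M"
    and W_le: "\<And>i. emeasure (W i) (space M) \<le> 1"
    and M: "\<And>A. A \<in> sets M \<Longrightarrow> measure M A = (\<Sum>i\<in>UNIV. w i * measure (W i) A)"
    and N: "\<And>A. A \<in> sets M \<Longrightarrow> measure N A = (\<Sum>i\<in>UNIV. w' i * measure (W i) A)"
  shows "tv_dist M N \<le> ennreal (\<Sum>i\<in>UNIV. \<bar>w i - w' i\<bar>)"
  unfolding tv_dist_def
proof (rule SUP_least)
  fix P assume "P \<in> {P. finite P \<and> partition_on (space M) P \<and> P \<subseteq> sets M}"
  then have P: "finite P" "partition_on (space M) P" "P \<subseteq> sets M" by auto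
  have mass: "(\<Sum>A\<in>P. measure (W i) A) \<le> 1" for i
  proof -
    have space: "space (W i) = space M" by (rule sets_eq_imp_space_eq[OF sets_W])
    interpret finite_measure "W i"
      using W_le[of i] by (intro finite_measureI) (auto simp: space top_unique)
    have "(\<Sum>A\<in>P. measure (W i) A) = measure (W i) (\<Union>A\<in>P. A)"
      using P by (intro finite_measure_finite_Union[symmetric])
        (auto simp: sets_W disjoint_family_on_def partition_on_def disjoint_def)
    also have "\<dots> = measure (W i) (space M)"
      using P(2) by (simp add: partition_on_def)
    also have "\<dots> \<le> 1"
      using W_le[of i] by (simp add: emeasure_eq_measure)
    finally show ?thesis .
  qed
  have "(\<Sum>A\<in>P. \<bar>measure M A - measure N A\<bar>)
      \<le> (\<Sum>A\<in>P. \<Sum>i\<in>UNIV. \<bar>w i - w' i\<bar> * measure (W i) A)"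
  proof (rule sum_mono)
    fix A assume "A \<in> P"
    then have A: "A \<in> sets M" using P by auto
    have "measure M A - measure N A = (\<Sum>i\<in>UNIV. (w i - w' i) * measure (W i) A)"
      by (simp add: M[OF A] N[OF A] left_diff_distrib sum_subtractf)
    then show "\<bar>measure M A - measure N A\<bar> \<le> (\<Sum>i\<in>UNIV. \<bar>w i - w' i\<bar> * measure (W i) A)"
      using sum_abs[of "\<lambda>i. (w i - w' i) * measure (W i) A" UNIV] by (simp add: abs_mult)
  qed
  also have "\<dots> = (\<Sum>i\<in>UNIV. \<bar>w i - w' i\<bar> * (\<Sum>A\<in>P. measure (W i) A))"
    by (subst sum.swap) (simp add: sum_distrib_left)
  also have "\<dots> \<le> (\<Sum>i\<in>UNIV. \<bar>w i - w' i\<bar> * 1)"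
    by (intro sum_mono mult_left_mono mass) auto
  finally show "(\<Sum>A\<in>P. ennreal \<bar>measure M A - measure N A\<bar>) \<le> ennreal (\<Sum>i\<in>UNIV. \<bar>w i - w' i\<bar>)"
    by (simp add: sum_ennreal)
qed

text \<open>
  A weighted sum of measures is countably additive, so the measure generated by it takes exactly
  these values instead of the default value \<open>0\<close>.
\<close>

lemma emeasure_mixture:
  fixes c :: "'i \<Rightarrow> ennreal" and W :: "'i \<Rightarrow> 'a measure"
  assumes W: "\<And>i. i \<in> I \<Longrightarrow> sets (W i) = sets M"
    and A: "A \<in> sets M"
  shows "emeasure (measure_of (space M) (sets M) (\<lambda>A. \<Sum>i\<in>I. c i * emeasure (W i) A)) A
     = (\<Sum>i\<in>I. c i * emeasure (W i) A)"
proof (rule emeasure_measure_of[OF refl])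
  show "sets M \<subseteq> Pow (space M)" by (rule sets.space_closed)
  show "A \<in> sets (measure_of (space M) (sets M) (\<lambda>A. \<Sum>i\<in>I. c i * emeasure (W i) A))"
    using A by (simp add: sets.space_closed sets.sigma_sets_eq)
  show "positive (sets (measure_of (space M) (sets M) (\<lambda>A. \<Sum>i\<in>I. c i * emeasure (W i) A)))
      (\<lambda>A. \<Sum>i\<in>I. c i * emeasure (W i) A)"
    by (simp add: positive_def)
  show "countably_additive
      (sets (measure_of (space M) (sets M) (\<lambda>A. \<Sum>i\<in>I. c i * emeasure (W i) A)))
      (\<lambda>A. \<Sum>i\<in>I. c i * emeasure (W i) A)"
  proof (rule countably_additiveI)
    fix B :: "nat \<Rightarrow> 'a set"
    assume "range B \<subseteq> sets (measure_of (space M) (sets M) (\<lambda>A. \<Sum>i\<in>I. c i * emeasure (W i) A))"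
      and disj: "disjoint_family B"
    then have B: "range B \<subseteq> sets M" by (simp add: sets.space_closed sets.sigma_sets_eq)
    have "(\<Sum>n. \<Sum>i\<in>I. c i * emeasure (W i) (B n)) = (\<Sum>i\<in>I. \<Sum>n. c i * emeasure (W i) (B n))"
      by (rule suminf_sum) auto
    also have "\<dots> = (\<Sum>i\<in>I. c i * emeasure (W i) (\<Union>n. B n))"
      using B disj W by (intro sum.cong refl) (simp add: suminf_emeasure)
    finally show "(\<Sum>n. \<Sum>i\<in>I. c i * emeasure (W i) (B n))
        = (\<Sum>i\<in>I. c i * emeasure (W i) (\<Union>n. B n))" .
  qed
qed

text \<open>
  The bound includes a conditioning event \<open>B\<close> of measure \<open>0\<close>: as \<open>0 / 0 = 0\<close> for extended
  nonnegative reals, the uniform measure is then \<open>0\<close>.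
\<close>

lemma emeasure_uniform_measure_le_1:
  assumes "B \<in> sets M" "A \<in> sets M"
  shows "emeasure (uniform_measure M B) A \<le> 1"
proof -
  have "emeasure (uniform_measure M B) A = emeasure M (B \<inter> A) / emeasure M B"
    using assms by (rule emeasure_uniform_measure)
  also have "\<dots> \<le> emeasure M B / emeasure M B"
    using assms by (intro divide_right_mono_ennreal emeasure_mono) auto
  also have "\<dots> \<le> 1"
    by (cases "emeasure M B = 0"; cases "emeasure M B = \<top>") (auto simp: ennreal_divide_self less_top)
  finally show ?thesis .
qed

lemma tendsto_tv_dist_mixture:
  fixes w :: "'b \<Rightarrow> 'i::finite \<Rightarrow> real" and W :: "'i \<Rightarrow> 'a measure"
  assumes "\<And>i. sets (W i) = S" and "\<And>i. emeasure (W i) (space (W i)) \<le> 1"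
    and "\<And>t. sets (M t) = S"
    and "\<And>t A. A \<in> S \<Longrightarrow> measure (M t) A = (\<Sum>i\<in>UNIV. w t i * measure (W i) A)"
    and "\<And>A. A \<in> S \<Longrightarrow> measure N A = (\<Sum>i\<in>UNIV. w' i * measure (W i) A)"
    and lim: "\<And>i. ((\<lambda>t. w t i) \<longlongrightarrow> w' i) F"
  shows "((\<lambda>t. tv_dist (M t) N) \<longlongrightarrow> 0) F"
proof (rule tendsto_sandwich[of "\<lambda>_. 0"])
  have "((\<lambda>t. \<Sum>i\<in>UNIV. \<bar>w t i - w' i\<bar>) \<longlongrightarrow> (\<Sum>i\<in>UNIV. \<bar>w' i - w' i\<bar>)) F"
    by (intro tendsto_intros lim)
  then show "((\<lambda>t. ennreal (\<Sum>i\<in>UNIV. \<bar>w t i - w' i\<bar>)) \<longlongrightarrow> 0) F"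
    using tendsto_ennrealI by fastforce
  show "\<forall>\<^sub>F t in F. tv_dist (M t) N \<le> ennreal (\<Sum>i\<in>UNIV. \<bar>w t i - w' i\<bar>)"
  proof (intro always_eventually allI tv_dist_mixture_le)
    fix t i
    show "sets (W i) = sets (M t)" by (simp add: assms)
    then have "space (W i) = space (M t)" by (rule sets_eq_imp_space_eq)
    then show "emeasure (W i) (space (M t)) \<le> 1" using assms(2)[of i] by simp
  qed (simp_all add: assms)
qed auto

lemma measure_eq_sum_of_emeasure:
  assumes "emeasure M A = (\<Sum>i\<in>UNIV. ennreal (w i) * emeasure (W i) A)"
    and "\<And>i. 0 \<le> w i" and "\<And>i. emeasure (W i) A \<le> 1"
  shows "measure M A = (\<Sum>i\<in>(UNIV :: 'i::finite set). w i * measure (W i) A)"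
proof -
  have "emeasure (W i) A = ennreal (measure (W i) A)" for i
    using assms(3)[of i] by (intro emeasure_eq_ennreal_measure) (auto simp: top_unique)
  then have "emeasure M A = ennreal (\<Sum>i\<in>UNIV. w i * measure (W i) A)"
    using assms(1,2) by (simp add: sum_ennreal flip: ennreal_mult)
  then show ?thesis
    using assms(2) by (simp add: measure_def[of M] sum_nonneg)
qed

section \<open>Convergence of couplings and path measures\<close>

lemma endpoint_event_measurable:
  "{\<omega> \<in> space path_space. \<omega> 0 = x \<and> \<omega> 1 = y} \<in> sets (path_space :: (real \<Rightarrow> 's) measure)"
proof -
  have [measurable]: "(\<lambda>\<omega>. \<omega> t) \<in> path_space \<rightarrow>\<^sub>M (count_space UNIV :: 's measure)"
    if "t \<in> {0..1}" for t :: real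
    unfolding path_space_def
    by (intro measurable_restrict_space1 measurable_component_singleton that)
  have [measurable]: "(\<lambda>\<omega>. \<omega> 0) \<in> path_space \<rightarrow>\<^sub>M (count_space UNIV :: 's measure)"
    "(\<lambda>\<omega>. \<omega> 1) \<in> path_space \<rightarrow>\<^sub>M (count_space UNIV :: 's measure)"
    by simp_all
  show ?thesis by measurable
qed

theorem corollary3p2:
  fixes Q K :: "real ^ 'n ^ 'n"
    and \<mu> \<nu> g\<^sub>0 g_star :: "real ^ 'n"
    and g :: "real \<Rightarrow> real ^ 'n"
    and R :: "(real \<Rightarrow> 'n) measure"
  assumes "is_generator Q"
    and "K = mat_exp Q"
    and "is_distribution \<mu>"
    and "is_distribution \<nu>"
    and "\<And>x y. K $ x $ y > 0"
    and "\<And>x. \<mu> $ x > 0"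
    and "\<And>y. \<nu> $ y > 0"
    and "g\<^sub>0 \<in> gauge_space \<nu>"
    and "g 0 = g\<^sub>0"
    and "\<And>t. t \<ge> 0 \<Longrightarrow>
           (g has_vector_derivative flow_field K \<mu> \<nu> (g t)) (at t within {0..})"
    and "g_star \<in> gauge_space \<nu>"
    and "marginal K \<mu> g_star = \<nu>"
    and "is_markov_law Q \<mu> R"
  shows "((\<lambda>t. tv_dist (coupling_measure K \<mu> (g t)) (coupling_measure K \<mu> g_star))
            \<longlongrightarrow> 0) at_top \<and>
         ((\<lambda>t. tv_dist (path_measure R K \<mu> (g t)) (path_measure R K \<mu> g_star))
            \<longlongrightarrow> 0) at_top"
proof
  note K = assms(5) and \<mu> = assms(6) and markov = \<open>is_markov_law Q \<mu> R\<close>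
  have flow: "(g has_vector_derivative flow_field K \<mu> (marginal K \<mu> g_star) (g t))
      (at t within {0..})" if "t \<ge> 0" for t
    using assms(10)[OF that] \<open>marginal K \<mu> g_star = \<nu>\<close> by simp
  define w where "w h = (\<lambda>(x, y). coupling K \<mu> h x y)" for h
  have w_nonneg: "0 \<le> w h i" for h i
    using coupling_pos[OF K \<mu>] by (cases i) (simp add: w_def less_imp_le)
  have w_lim: "((\<lambda>t. w (g t) i) \<longlongrightarrow> w g_star i) at_top" for i
    using tendsto_coupling_of_differences[OF K tendsto_flow_differences[OF K \<mu> flow]]
    by (cases i) (simp add: w_def)
  show "((\<lambda>t. tv_dist (coupling_measure K \<mu> (g t)) (coupling_measure K \<mu> g_star))
      \<longlongrightarrow> 0) at_top"
  proof (rule tendsto_tv_dist_mixture[OF _ _ _ _ _ w_lim])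
    let ?W = "return (count_space UNIV) :: 'n \<times> 'n \<Rightarrow> _"
    show "sets (?W i) = UNIV" "emeasure (?W i) (space (?W i)) \<le> 1" for i by simp_all
    show "sets (coupling_measure K \<mu> (g t)) = UNIV" for t
      by (simp add: coupling_measure_def sets_point_measure)
    have "measure (coupling_measure K \<mu> h) A = (\<Sum>i\<in>UNIV. w h i * measure (?W i) A)" for h A
    proof (rule measure_eq_sum_of_emeasure[OF _ w_nonneg])
      have "emeasure (coupling_measure K \<mu> h) A = (\<Sum>i\<in>A. ennreal (w h i))"
        by (simp add: coupling_measure_def emeasure_point_measure_finite w_def case_prod_unfold)
      also have "\<dots> = (\<Sum>i\<in>UNIV. ennreal (w h i) * emeasure (?W i) A)"
        by (simp add: indicator_def if_distrib sum.If_cases cong: if_cong)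
      finally show "emeasure (coupling_measure K \<mu> h) A
          = (\<Sum>i\<in>UNIV. ennreal (w h i) * emeasure (?W i) A)" .
    qed (simp add: indicator_def)
    then show "measure (coupling_measure K \<mu> (g t)) A = (\<Sum>i\<in>UNIV. w (g t) i * measure (?W i) A)"
      "measure (coupling_measure K \<mu> g_star) A = (\<Sum>i\<in>UNIV. w g_star i * measure (?W i) A)"
      for t A by auto
  qed
  show "((\<lambda>t. tv_dist (path_measure R K \<mu> (g t)) (path_measure R K \<mu> g_star))
      \<longlongrightarrow> 0) at_top"
  proof (rule tendsto_tv_dist_mixture[OF _ _ _ _ _ w_lim])
    let ?S = "sets (path_space :: (real \<Rightarrow> 'n) measure)"
    let ?W = "\<lambda>(x, y). bridge R x y"
    have R: "space R = space path_space" "sets R = ?S"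
      using markov by (auto simp: is_markov_law_def)
    have event: "{\<omega> \<in> space R. \<omega> 0 = x \<and> \<omega> 1 = y} \<in> sets R" for x y
      unfolding R by (rule endpoint_event_measurable)
    show sets_W: "sets (?W i) = ?S" for i
      by (cases i) (simp add: bridge_def R)
    have le: "emeasure (?W i) A \<le> 1" if "A \<in> ?S" for i A
      using that emeasure_uniform_measure_le_1[OF event] by (cases i) (simp add: bridge_def R)
    show "emeasure (?W i) (space (?W i)) \<le> 1" for i
      by (rule le) (metis sets_W sets.top)
    show "sets (path_measure R K \<mu> (g t)) = ?S" for t
      by (simp add: path_measure_def sets.space_closed sets.sigma_sets_eq)
    have "measure (path_measure R K \<mu> h) A = (\<Sum>i\<in>UNIV. w h i * measure (?W i) A)"
      if A: "A \<in> ?S" for h A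
    proof (rule measure_eq_sum_of_emeasure[OF _ w_nonneg le[OF A]])
      have "path_measure R K \<mu> h = measure_of (space path_space) ?S
          (\<lambda>A. \<Sum>i\<in>UNIV. ennreal (w h i) * emeasure (?W i) A)"
        by (simp add: path_measure_def w_def sum.cartesian_product case_prod_unfold)
      then show "emeasure (path_measure R K \<mu> h) A
          = (\<Sum>i\<in>UNIV. ennreal (w h i) * emeasure (?W i) A)"
        using emeasure_mixture[OF sets_W A] by simp
    qed
    then show "A \<in> ?S \<Longrightarrow>
        measure (path_measure R K \<mu> (g t)) A = (\<Sum>i\<in>UNIV. w (g t) i * measure (?W i) A)"
      "A \<in> ?S \<Longrightarrow>
        measure (path_measure R K \<mu> g_star) A = (\<Sum>i\<in>UNIV. w g_star i * measure (?W i) A)"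
      for t A by auto
  qed
qed

end
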